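(* Let $I_1, I_2 \subseteq \mathbb{R}$ be nonempty open intervals, let $J = \frac12(I_1+I_2)$, and let $\varphi : J \to \mathbb{R}$, $\psi_1 : I_1 \to \mathbb{R}$, $\psi_2 : I_2 \to \mathbb{R}$ be functions. Consider the functional equation \[ (\ast)\qquad \varphi\left(\frac{x+y}{2}\right)\bigl(\psi_1(x)-\psi_2(y)\bigr)=0 \qquad \text{for all } x \in I_1 \text{ and } y \in I_2 . \] Suppose that $(\varphi,\psi_1,\psi_2)$ satisfies $(\ast)$ and that there exists a differentiable function $\Phi : J \to \mathbb{R}$ such that $\varphi(u)=\Phi'(u)$ for every $u\in J$. Then exactly one of the following statements is true. (1) $\varphi(u)=0$ for all $u \in J$, or there exists $\lambda \in \mathbb{R}$ such that $\psi_1(x)=\psi_2(y)=\lambda$ for all $x \in I_1$ and $y \in I_2$. (2) There exist constants $\lambda,\nu \in \mathbb{R}$ and, for $i=1,2$, there exist $a_i, b_i \in \overline{\mathbb{R}}$ such that $\inf I_i \le a_i \le b_i \le \sup I_i$ and for the open intervals $U_i := \left]\inf I_i, a_i\right[$ and $V_i := \left]b_i, \sup I_i\right[$ the following assertions are fulfilled: - $U_i \ne I_i$ and $V_i \neq I_i$ for $i=1,2$; - $U_1, U_2$ are both nonempty or $V_1, V_2$ are both nonempty; - $\psi_1(x)=\psi_2(y)=\lambda$ for all $(x,y) \in U_1\times U_2$, and $\psi_1(x)=\psi_2(y)=\nu$ for all $(x,y)\in V_1 \times V_2$; - $\varphi(u)=0$ for all $u \in \frac12(K_1+I_2) \cup \frac12(I_1+K_2)$,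 where $K_i := I_i \setminus (U_i \cup V_i)$ is a nonempty subinterval which is closed in $I_i$ ($i=1,2$). (3) There exist a constant $\lambda\in\mathbb{R}$ and an index $j \in\{1,2\}$ such that $\psi_j(z)=\lambda$ for all $z \in I_j$, while, for the index $i \in \{1,2\}$ with $i\neq j$, there exists a finite or countable collection of disjoint, nonempty open intervals $U_n \subset I_i$ ($n=1,\dots,N$, where $N\in\mathbb{N}$ or $N=\infty$) such that \[ \bigcup_{n=1}^N U_n \ne I_i, \qquad \psi_i(z)=\lambda \ \text{ for all } z\in \bigcup_{n=1}^N U_n, \] and moreover \[ \varphi(t)=0 \ \text{ for all } t \in \frac12\left(\left(I_i \setminus \bigcup_{n=1}^N U_n\right)+I_j\right). \] Conversely, if there exist nonempty open intervals $I_1, I_2 \subseteq \mathbb{R}$, $J=\frac12(I_1+I_2)$ such that for the functions $\psi_1 : I_1 \to \mathbb{R}$, $\psi_2 : I_2 \to \mathbb{R}$ and $\varphi : J \to \mathbb{R}$ one of the three cases (1), (2), (3) above holds, then the triplet $(\varphi,\psi_1,\psi_2)$ satisfies $(\ast)$.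
   Context: $\overline{\mathbb{R}} = \mathbb{R}\cup\{-\infty,+\infty\}$. For sets $A,B\subseteq\mathbb{R}$, $\frac12(A+B)=\{\frac{a+b}{2} : a\in A,\ b\in B\}$. $\left]\alpha,\beta\right[$ denotes the open interval $\{t \in \mathbb{R}: \alpha<t<\beta\}$ with $\alpha\le\beta$ in $\overline{\mathbb{R}}$; it is empty when $\alpha=\beta$, even if these are infinite.
   Formalization: "Exactly one of the following statements is true" is replaced by "at least one": the three cases can overlap (all hold for φ=0, ψ₁=ψ₂=0, and (2) and (3) can hold together without (1)), so the exclusivity claimed is false. *)

theory Defs
  imports "HOL-Analysis.Analysis"
begin

text \<open>
  The pairs \<open>I\<^sub>1, I\<^sub>2\<close> and \<open>\<psi>\<^sub>1, \<psi>\<^sub>2\<close> are families over \<open>nat\<close>, of which only the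
  members 1 and 2 are used. Functions defined on \<open>I\<^sub>i\<close> or on \<open>J\<close> are total functions on
  the reals of which only the values on that set are used.
\<close>

definition half_sum :: "real set \<Rightarrow> real set \<Rightarrow> real set" where
  "half_sum A B = {(a + b) / 2 | a b. a \<in> A \<and> b \<in> B}"

definition nonempty_open_interval :: "real set \<Rightarrow> bool" where
  "nonempty_open_interval I \<longleftrightarrow> open I \<and> is_interval I \<and> I \<noteq> {}"

text \<open>Infimum and supremum in the extended reals.\<close>

definition einf :: "real set \<Rightarrow> ereal" where
  "einf I = (INF x\<in>I. ereal x)"

definition esup :: "real set \<Rightarrow> ereal" where
  "esup I = (SUP x\<in>I. ereal x)"

definition solves_eq :: "(nat \<Rightarrow> real set) \<Rightarrow> (real \<Rightarrow> real) \<Rightarrow> (nat \<Rightarrow> real \<Rightarrow> real) \<Rightarrow> bool" where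
  "solves_eq I \<phi> \<psi> \<longleftrightarrow>
     (\<forall>x \<in> I 1. \<forall>y \<in> I 2. \<phi> ((x + y) / 2) * (\<psi> 1 x - \<psi> 2 y) = 0)"

definition case_1 :: "(nat \<Rightarrow> real set) \<Rightarrow> (real \<Rightarrow> real) \<Rightarrow> (nat \<Rightarrow> real \<Rightarrow> real) \<Rightarrow> bool" where
  "case_1 I \<phi> \<psi> \<longleftrightarrow>
     (\<forall>u \<in> half_sum (I 1) (I 2). \<phi> u = 0) \<or>
     (\<exists>c. \<forall>x \<in> I 1. \<forall>y \<in> I 2. \<psi> 1 x = c \<and> \<psi> 2 y = c)"

definition case_2 :: "(nat \<Rightarrow> real set) \<Rightarrow> (real \<Rightarrow> real) \<Rightarrow> (nat \<Rightarrow> real \<Rightarrow> real) \<Rightarrow> bool" where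
  "case_2 I \<phi> \<psi> \<longleftrightarrow>
     (\<exists>(c::real) (d::real) (a :: nat \<Rightarrow> ereal) (b :: nat \<Rightarrow> ereal).
        (\<forall>i \<in> {1, 2}. einf (I i) \<le> a i \<and> a i \<le> b i \<and> b i \<le> esup (I i)) \<and>
        (let U = (\<lambda>i. einterval (einf (I i)) (a i));
             V = (\<lambda>i. einterval (b i) (esup (I i)));
             K = (\<lambda>i. I i - (U i \<union> V i))
         in (\<forall>i \<in> {1, 2}. U i \<noteq> I i \<and> V i \<noteq> I i) \<and>
            (U 1 \<noteq> {} \<and> U 2 \<noteq> {} \<or> V 1 \<noteq> {} \<and> V 2 \<noteq> {}) \<and>
            (\<forall>x \<in> U 1. \<forall>y \<in> U 2. \<psi> 1 x = c \<and> \<psi> 2 y = c) \<and>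
            (\<forall>x \<in> V 1. \<forall>y \<in> V 2. \<psi> 1 x = d \<and> \<psi> 2 y = d) \<and>
            (\<forall>i \<in> {1, 2}. K i \<noteq> {} \<and> is_interval (K i) \<and> closedin (top_of_set (I i)) (K i)) \<and>
            (\<forall>u \<in> half_sum (K 1) (I 2) \<union> half_sum (I 1) (K 2). \<phi> u = 0)))"

definition case_3 :: "(nat \<Rightarrow> real set) \<Rightarrow> (real \<Rightarrow> real) \<Rightarrow> (nat \<Rightarrow> real \<Rightarrow> real) \<Rightarrow> bool" where
  "case_3 I \<phi> \<psi> \<longleftrightarrow>
     (\<exists>c. \<exists>j \<in> {1, 2}. (\<forall>z \<in> I j. \<psi> j z = c) \<and>
        (\<exists>i \<in> {1, 2}. i \<noteq> j \<and>
          (\<exists>\<U>. countable \<U> \<and> \<U> \<noteq> {} \<and> disjoint \<U> \<and>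
             (\<forall>U \<in> \<U>. nonempty_open_interval U \<and> U \<subseteq> I i) \<and>
             \<Union>\<U> \<noteq> I i \<and>
             (\<forall>z \<in> \<Union>\<U>. \<psi> i z = c) \<and>
             (\<forall>t \<in> half_sum (I i - \<Union>\<U>) (I j). \<phi> t = 0))))"

text \<open>
  The three cases are not mutually exclusive for solutions in which \<open>\<phi>\<close> is a derivative:
  all of them can hold simultaneously, and so can the last two without the first.
  Hence a case distinction over them is exhaustive but cannot be exclusive.
\<close>

lemma cases_2_3_overlap_aux:
  fixes \<phi> :: "real \<Rightarrow> real" and \<psi> :: "nat \<Rightarrow> real \<Rightarrow> real"
  assumes \<phi>: "\<And>u. u \<ge> 1/2 \<Longrightarrow> \<phi> u = 0"
    and \<psi>2: "\<And>y. \<psi> 2 y = 0"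
    and \<psi>1: "\<And>x. x < 1 \<Longrightarrow> \<psi> 1 x = 0"
  shows "case_2 (\<lambda>_. {0<..<2}) \<phi> \<psi>" "case_3 (\<lambda>_. {0<..<2}) \<phi> \<psi>"
proof -
  have einf: "einf {0<..<2} = 0" and esup: "esup {0<..<2} = 2"
  proof -
    have "x \<in> ereal ` {0<..<2}" if "0 < x" "x < 2" for x
      using that by (cases x) auto
    then have im: "ereal ` {0<..<2} = {0<..<2}"
      by auto
    show "einf {0<..<2} = 0" "esup {0<..<2} = 2"
      unfolding einf_def esup_def im by simp_all
  qed
  have U: "einterval 0 1 = {0<..<1}" and V: "einterval 2 2 = {}"
    by (auto simp: einterval_def)
  have K: "{0<..<2} - {0<..<1} = {1..<2::real}"
    by auto
  have closed: "closedin (top_of_set {0<..<2}) {1..<2::real}"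
    unfolding closedin_closed by (intro exI[of _ "{1..}"]) auto
  have zero: "\<phi> u = 0" if "u \<in> half_sum {1..<2} {0<..<2} \<union> half_sum {0<..<2} {1..<2}" for u
    using that by (intro \<phi>) (auto simp: half_sum_def)
  have "3/2 \<in> {0<..<2::real}" "3/2 \<notin> {0<..<1::real}"
    by simp_all
  then have nsub: "\<not> {0<..<2::real} \<subseteq> {0<..<1}" "{0<..<1} \<noteq> {0<..<2::real}"
    by blast+
  have \<psi>1': "\<forall>x\<in>{0<..<1}. \<psi> (Suc 0) x = 0"
    using \<psi>1 by simp
  show "case_2 (\<lambda>_. {0<..<2}) \<phi> \<psi>"
    unfolding case_2_def
    by (rule exI[of _ 0], rule exI[of _ 0], rule exI[of _ "\<lambda>_. 1"], rule exI[of _ "\<lambda>_. 2"])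
       (use zero nsub in \<open>simp add: einf esup U V K closed Let_def \<psi>2 \<psi>1' is_interval_co\<close>)
  show "case_3 (\<lambda>_. {0<..<2}) \<phi> \<psi>"
    unfolding case_3_def
    by (rule exI[of _ 0], rule bexI[of _ 2], rule conjI, simp add: \<psi>2, rule bexI[of _ 1],
        simp, rule exI[of _ "{{0<..<1}}"])
       (use zero nsub \<psi>1 in \<open>auto simp: K nonempty_open_interval_def is_interval_oo\<close>)
qed

lemma cases_1_2_3_overlap:
  "\<exists>I \<phi> \<psi>. nonempty_open_interval (I 1) \<and> nonempty_open_interval (I 2) \<and>
     solves_eq I \<phi> \<psi> \<and>
     (\<exists>\<Phi>. \<forall>u \<in> half_sum (I 1) (I 2).
        (\<Phi> has_real_derivative \<phi> u) (at u within half_sum (I 1) (I 2))) \<and>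
     case_1 I \<phi> \<psi> \<and> case_2 I \<phi> \<psi> \<and> case_3 I \<phi> \<psi>"
  by (rule exI[of _ "\<lambda>_. {0<..<2}"], rule exI[of _ "\<lambda>_. 0"], rule exI[of _ "\<lambda>_ _. 0"])
     (auto simp: nonempty_open_interval_def is_interval_oo solves_eq_def case_1_def
        intro!: cases_2_3_overlap_aux exI[of _ "\<lambda>_. 0"])

lemma cases_2_3_overlap:
  "\<exists>I \<phi> \<psi>. nonempty_open_interval (I 1) \<and> nonempty_open_interval (I 2) \<and>
     solves_eq I \<phi> \<psi> \<and>
     (\<exists>\<Phi>. \<forall>u \<in> half_sum (I 1) (I 2).
        (\<Phi> has_real_derivative \<phi> u) (at u within half_sum (I 1) (I 2))) \<and>
     \<not> case_1 I \<phi> \<psi> \<and> case_2 I \<phi> \<psi> \<and> case_3 I \<phi> \<psi>"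
proof -
  define I :: "nat \<Rightarrow> real set" where "I = (\<lambda>_. {0<..<2})"
  define \<phi> :: "real \<Rightarrow> real" where "\<phi> = (\<lambda>u. max 0 (1/2 - u))"
  define \<psi> :: "nat \<Rightarrow> real \<Rightarrow> real" where "\<psi> = (\<lambda>i x. if i = 1 \<and> x \<ge> 1 then 1 else 0)"
  have J: "half_sum (I 1) (I 2) \<subseteq> {0..2}"
    by (auto simp: half_sum_def I_def)
  have "continuous_on {0..2} \<phi>"
    unfolding \<phi>_def by (intro continuous_intros)
  then obtain \<Phi> where "\<And>u. u \<in> {0..2} \<Longrightarrow> (\<Phi> has_vector_derivative \<phi> u) (at u within {0..2})"
    by (rule antiderivative_continuous) blast
  then have deriv: "\<forall>u \<in> half_sum (I 1) (I 2).
      (\<Phi> has_real_derivative \<phi> u) (at u within half_sum (I 1) (I 2))"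
    using J by (blast intro: has_vector_derivative_within_subset
        has_real_derivative_iff_has_vector_derivative[THEN iffD2])
  have solves: "solves_eq I \<phi> \<psi>"
    by (auto simp: solves_eq_def I_def \<phi>_def \<psi>_def max_def)
  have not1: "\<not> case_1 I \<phi> \<psi>"
  proof -
    have "1/4 \<in> half_sum (I 1) (I 2)"
      unfolding half_sum_def I_def by (auto intro!: exI[of _ "1/4::real"])
    moreover have "\<phi> (1/4) \<noteq> 0"
      by (simp add: \<phi>_def)
    moreover have "1 \<in> I 1" "1 \<in> I 2" "\<psi> 1 1 = 1" "\<psi> 2 1 = 0"
      by (auto simp: I_def \<psi>_def)
    ultimately show ?thesis
      unfolding case_1_def by fastforce
  qed
  have "case_2 I \<phi> \<psi>" "case_3 I \<phi> \<psi>"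
    unfolding I_def by (rule cases_2_3_overlap_aux; simp add: \<phi>_def \<psi>_def)+
  with deriv solves not1 show ?thesis
    by (intro exI[of _ I] exI[of _ \<phi>] exI[of _ \<psi>])
       (auto simp: nonempty_open_interval_def I_def is_interval_oo)
qed

end

theory Submission
  imports Defs
begin

text \<open>
  If a derivative \<open>\<phi>\<close> vanishes almost everywhere on an interval, its primitive is constant by the
  Henstock--Kurzweil fundamental theorem, so \<open>\<phi> = 0\<close> there. Hence \<open>{\<phi> \<noteq> 0}\<close> has positive measure near
  each of its points, and by Steinhaus its differences fill a neighbourhood of \<open>0\<close>. If \<open>\<phi> u\<close> and
  \<open>\<phi> (u + h/2)\<close> are nonzero, then \<open>\<psi>\<^sub>1 (x + h) = \<psi>\<^sub>2 (2 u - x) = \<psi>\<^sub>1 x\<close>; so \<open>\<psi>\<^sub>1\<close> is locally constant on the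
  open set \<open>L\<^sub>1\<close> of those \<open>x\<close> with \<open>\<phi> ((x + y)/2) \<noteq> 0\<close> for some \<open>y\<close>, and likewise \<open>\<psi>\<^sub>2\<close> on \<open>L\<^sub>2\<close>.
  Put \<open>K\<^sub>i = I\<^sub>i - L\<^sub>i\<close>. If some \<open>K\<^sub>j\<close> is empty, \<open>\<psi>\<^sub>j\<close> is constant and case (1) or (3) holds, the intervals
  in (3) being the components of \<open>L\<^sub>i\<close>. If both are nonempty and \<open>\<phi> ((x + y)/2) \<noteq> 0\<close>, then \<open>x\<close> and \<open>y\<close>
  lie on the same side of all of \<open>K\<^sub>1\<close> and \<open>K\<^sub>2\<close> respectively, for otherwise \<open>x\<close> and \<open>y\<close> could be
  moved in opposite directions, with \<open>x + y\<close> fixed, until \<open>x \<in> K\<^sub>1\<close> or \<open>y \<in> K\<^sub>2\<close>. This gives (2).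
\<close>

section \<open>Steinhaus' theorem and the nonzero set of a derivative\<close>

text \<open>Squeeze a compact \<open>T\<close> of positive measure inside \<open>S\<close> and an
  open \<open>B\<close> around it of measure less than twice that of \<open>T\<close>. A short
  translate of \<open>T\<close> stays in \<open>B\<close>, where two disjoint copies of
  \<open>T\<close> do not fit.\<close>

lemma steinhaus:
  fixes S :: "'a::euclidean_space set"
  assumes S: "S \<in> lmeasurable" "bounded S" and pos: "\<not> negligible S"
  shows "\<exists>e>0. \<forall>h. norm h < e \<longrightarrow> (\<exists>x\<in>S. h + x \<in> S)"
proof -
  let ?\<mu> = "measure lebesgue"
  have "?\<mu> S > 0"
    using S pos by (simp add: negligible_iff_measure0 zero_less_measure_iff less_le)
  then obtain T where T: "closed T" "T \<subseteq> S" "S - T \<in> lmeasurable" "emeasure lebesgue (S - T) < ennreal (?\<mu> S)"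
    using sets_lebesgue_inner_closed[of S "?\<mu> S"] S by (auto dest: fmeasurableD)
  have "T \<in> lmeasurable"
    using T S by (metis fmeasurable.Diff double_diff order_refl)
  have "?\<mu> (S - T) < ?\<mu> S"
    using T by (simp add: emeasure_eq_measure2 ennreal_less_iff)
  then have "?\<mu> T > 0"
    using \<open>T \<in> lmeasurable\<close> T S by (simp add: measurable_measure_Diff fmeasurableD)
  then obtain B where B: "open B" "T \<subseteq> B" "B - T \<in> lmeasurable" "emeasure lebesgue (B - T) < ennreal (?\<mu> T)"
    using sets_lebesgue_outer_open[of T "?\<mu> T"] \<open>T \<in> lmeasurable\<close> by (auto dest: fmeasurableD)
  have "B \<in> lmeasurable"
    using B \<open>T \<in> lmeasurable\<close> by (metis Diff_partition fmeasurable.Un)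
  have "?\<mu> (B - T) < ?\<mu> T"
    using B by (simp add: emeasure_eq_measure2 ennreal_less_iff)
  then have less: "?\<mu> B < 2 * ?\<mu> T"
    using \<open>T \<in> lmeasurable\<close> \<open>B \<in> lmeasurable\<close> B by (simp add: measurable_measure_Diff fmeasurableD)
  \<comment> \<open>Compactness, due to boundedness of \<open>S\<close>, gives one radius
    \<open>e\<close> that serves all points of \<open>T\<close>.\<close>
  have "compact T"
    using T S bounded_subset compact_eq_bounded_closed by blast
  then obtain e where e: "e > 0" "(\<Union>x\<in>T. ball x e) \<subseteq> B"
    using B compact_subset_open_imp_ball_epsilon_subset by metis
  have "\<exists>x\<in>S. h + x \<in> S" if h: "norm h < e" for h
  proof (rule ccontr)
    assume "\<not> ?thesis"
    then have "T \<inter> (+) h ` T = {}"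
      using T by auto
    then have "?\<mu> (T \<union> (+) h ` T) = 2 * ?\<mu> T"
      using \<open>T \<in> lmeasurable\<close> by (simp add: measure_Un2 measurable_translation measure_translation Diff_triv Int_commute)
    moreover have "h + x \<in> B" if "x \<in> T" for x
    proof -
      have "h + x \<in> ball x e"
        using h by (simp add: dist_norm)
      then show ?thesis
        using e(2) that by blast
    qed
    then have "T \<union> (+) h ` T \<subseteq> B"
      using B by auto
    then have "?\<mu> (T \<union> (+) h ` T) \<le> ?\<mu> B"
      using \<open>T \<in> lmeasurable\<close> \<open>B \<in> lmeasurable\<close>
      by (intro measure_mono_fmeasurable) (auto simp: fmeasurableD measurable_translation intro!: sets.Un)
    ultimately show False
      using less by simp
  qed
  then show ?thesis
    using e(1) by blast
qed

text \<open>A derivative need not be Lebesgue integrable, but it is always Henstock--Kurzweil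
  integrable, and this already forces measurability.\<close>

lemma derivative_nonzero_lmeasurable:
  fixes \<phi> :: "real \<Rightarrow> real"
  assumes "a \<le> b"
    and \<Phi>: "\<And>u. u \<in> {a..b} \<Longrightarrow> (\<Phi> has_real_derivative \<phi> u) (at u within {a..b})"
  shows "{u \<in> {a..b}. \<phi> u \<noteq> 0} \<in> lmeasurable"
proof -
  have "\<phi> integrable_on {a..b}"
    using fundamental_theorem_of_calculus[OF \<open>a \<le> b\<close>, of \<Phi> \<phi>] \<Phi>
    unfolding has_real_derivative_iff_has_vector_derivative integrable_on_def by blast
  then have [measurable]: "\<phi> \<in> borel_measurable (lebesgue_on {a..b})"
    by (rule integrable_imp_measurable)
  have "{u \<in> space (lebesgue_on {a..b}). \<phi> u \<noteq> 0} \<in> sets (lebesgue_on {a..b})"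
    by measurable
  then have "{u \<in> {a..b}. \<phi> u \<noteq> 0} \<in> sets lebesgue"
    by (simp add: sets_restrict_space_iff space_restrict_space)
  then show ?thesis
    by (rule bounded_set_imp_lmeasurable[OF bounded_subset[OF bounded_closed_interval[of a b]], rotated]) blast
qed

lemma derivative_nonzero_not_negligible:
  fixes \<phi> :: "real \<Rightarrow> real"
  assumes "a < b"
    and \<Phi>: "\<And>u. u \<in> {a..b} \<Longrightarrow> (\<Phi> has_real_derivative \<phi> u) (at u within {a..b})"
    and c: "c \<in> {a..b}" "\<phi> c \<noteq> 0"
  shows "\<not> negligible {u \<in> {a..b}. \<phi> u \<noteq> 0}"
proof
  assume null: "negligible {u \<in> {a..b}. \<phi> u \<noteq> 0}"
  have \<Phi>': "(\<Phi> has_vector_derivative \<phi> u) (at u within {a..b})" if "u \<in> {a..b}" for u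
    using \<Phi>[OF that] unfolding has_real_derivative_iff_has_vector_derivative .
  have "\<Phi> x = \<Phi> a" if x: "x \<in> {a..b}" for x
  proof -
    \<comment> \<open>The integral of \<open>\<phi>\<close> is computed twice: by the fundamental
      theorem, and as that of the zero function altered on a null set.\<close>
    have "(\<phi> has_integral \<Phi> x - \<Phi> a) {a..x}"
    proof (rule fundamental_theorem_of_calculus)
      fix u assume "u \<in> {a..x}"
      then show "(\<Phi> has_vector_derivative \<phi> u) (at u within {a..x})"
        using x by (intro has_vector_derivative_within_subset[OF \<Phi>']) auto
    qed (use x in auto)
    moreover have "(\<phi> has_integral 0) {a..x}"
    proof (rule has_integral_spike[OF null])
      show "\<phi> u = 0" if "u \<in> {a..x} - {u \<in> {a..b}. \<phi> u \<noteq> 0}" for u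
        using that x by auto
      show "((\<lambda>_. 0) has_integral 0) {a..x}"
        by (rule has_integral_0)
    qed
    ultimately show ?thesis
      using has_integral_unique[of \<phi> "\<Phi> x - \<Phi> a" "{a..x}" 0] by simp
  qed
  then have "(\<Phi> has_vector_derivative 0) (at c within {a..b})"
    by (rule has_vector_derivative_transform[OF c(1) _ has_vector_derivative_const])
  moreover have "(\<Phi> has_vector_derivative \<phi> c) (at c within {a..b})"
    using \<Phi>' c by blast
  \<comment> \<open>Although \<open>c\<close> may be an endpoint, the derivative within a
    nondegenerate interval is unique.\<close>
  ultimately have "0 = \<phi> c"
    using \<open>a < b\<close> c vector_derivative_unique_within_closed_interval[of a b c \<Phi> 0 "\<phi> c"] by simp
  then show False
    using c by simp
qed

section \<open>Half sums and live points\<close>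

text \<open>These are the sets \<open>L\<^sub>1\<close> and \<open>L\<^sub>2\<close>, the latter by
  swapping \<open>A\<close> and \<open>B\<close>. Points of \<open>A\<close> outside
  \<open>live \<phi> A B\<close> are those whose midpoints with all of \<open>B\<close> are zeros of
  \<open>\<phi>\<close>.\<close>

definition live :: "(real \<Rightarrow> real) \<Rightarrow> real set \<Rightarrow> real set \<Rightarrow> real set" where
  "live \<phi> A B = {x \<in> A. \<exists>y\<in>B. \<phi> ((x + y) / 2) \<noteq> 0}"

lemma half_sumI: "a \<in> A \<Longrightarrow> b \<in> B \<Longrightarrow> (a + b) / 2 \<in> half_sum A B"
  unfolding half_sum_def by blast

lemma half_sumE:
  assumes "u \<in> half_sum A B"
  obtains a b where "u = (a + b) / 2" "a \<in> A" "b \<in> B"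
  using assms unfolding half_sum_def by blast

lemma half_sum_mono: "A \<subseteq> A' \<Longrightarrow> B \<subseteq> B' \<Longrightarrow> half_sum A B \<subseteq> half_sum A' B'"
  unfolding half_sum_def by blast

lemma half_sum_commute: "half_sum A B = half_sum B A"
proof -
  have "half_sum C D \<subseteq> half_sum D C" for C D
  proof
    fix u assume "u \<in> half_sum C D"
    then obtain c d where "u = (c + d) / 2" "c \<in> C" "d \<in> D"
      by (rule half_sumE)
    then show "u \<in> half_sum D C"
      using half_sumI[of d D c C] by (simp only: add.commute)
  qed
  then show ?thesis
    by blast
qed

text \<open>Move \<open>x\<close> towards \<open>k\<close> and \<open>y\<close> towards
  \<open>l\<close> with \<open>x + y\<close> fixed; by the last hypothesis these are opposite
  directions. The shorter distance is covered first, and the other coordinate is then still between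
  its start and its target, hence in its interval.\<close>

lemma half_sum_cross:
  assumes "is_interval A" "is_interval B" "k \<in> A" "l \<in> B" "x \<in> A" "y \<in> B"
    and "x \<le> k \<and> l \<le> y \<or> k \<le> x \<and> y \<le> l"
  shows "(x + y) / 2 \<in> half_sum {k} B \<union> half_sum A {l}"
proof -
  have "x + y - k \<in> B \<or> x + y - l \<in> A"
  proof (cases "\<bar>x - k\<bar> \<le> \<bar>y - l\<bar>")
    case True
    then have "l \<le> x + y - k \<and> x + y - k \<le> y \<or> y \<le> x + y - k \<and> x + y - k \<le> l"
      using assms(7) by linarith
    then show ?thesis
      using assms by (meson mem_is_interval_1_I)
  next
    case False
    then have "k \<le> x + y - l \<and> x + y - l \<le> x \<or> x \<le> x + y - l \<and> x + y - l \<le> k"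
      using assms(7) by linarith
    then show ?thesis
      using assms by (meson mem_is_interval_1_I)
  qed
  then show ?thesis
    using half_sumI[of k "{k}" "x + y - k" B] half_sumI[of "x + y - l" A l "{l}"] by auto
qed

lemma half_sum_not_live:
  assumes "u \<in> half_sum (A - live \<phi> A B) B"
  shows "\<phi> u = 0"
proof -
  obtain a b where u: "u = (a + b) / 2" and "a \<in> A - live \<phi> A B" "b \<in> B"
    using assms by (rule half_sumE)
  then have "\<phi> ((a + b) / 2) = 0"
    by (auto simp: live_def)
  then show ?thesis
    by (simp only: u)
qed

lemma common_ball:
  fixes A B :: "'a::metric_space set"
  assumes "open A" "x \<in> A" "open B" "y \<in> B"
  obtains d where "d > 0" "ball x d \<subseteq> A" "ball y d \<subseteq> B"
proof -
  obtain d1 d2 where "d1 > 0" "ball x d1 \<subseteq> A" "d2 > 0" "ball y d2 \<subseteq> B"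
    using assms by (meson open_contains_ball)
  then show ?thesis
    by (intro that[of "min d1 d2"]) auto
qed

text \<open>A small shift of \<open>x\<close> is compensated by the opposite shift of its partner
  \<open>y\<close>, which leaves the midpoint unchanged.\<close>

lemma open_live:
  assumes "open A" "open B"
  shows "open (live \<phi> A B)"
proof (rule openI)
  fix x assume "x \<in> live \<phi> A B"
  then obtain y where y: "x \<in> A" "y \<in> B" "\<phi> ((x + y) / 2) \<noteq> 0"
    by (auto simp: live_def)
  then obtain d where d: "d > 0" "ball x d \<subseteq> A" "ball y d \<subseteq> B"
    using common_ball[of A x B y] assms by blast
  have "x' \<in> live \<phi> A B" if "x' \<in> ball x d" for x'
  proof -
    have "x' \<in> A" "y - (x' - x) \<in> B"
    proof -
      have "y - (x' - x) \<in> ball y d"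
        using that by (simp add: dist_real_def abs_minus_commute)
      then show "x' \<in> A" "y - (x' - x) \<in> B"
        using d that by blast+
    qed
    moreover have "(x' + (y - (x' - x))) / 2 = (x + y) / 2"
      by simp
    ultimately show ?thesis
      using y(3) unfolding live_def
      by (intro CollectI conjI bexI[of _ "y - (x' - x)"]) (simp_all only: not_False_eq_True)
  qed
  then show "\<exists>e>0. ball x e \<subseteq> live \<phi> A B"
    using d by blast
qed

section \<open>Local constancy at live points\<close>

lemma locally_constant_on_live:
  fixes f g :: "real \<Rightarrow> real"
  assumes A: "open A" and B: "open B"
    and \<Phi>: "\<And>u. u \<in> half_sum A B \<Longrightarrow> (\<Phi> has_real_derivative \<phi> u) (at u within half_sum A B)"
    and eq: "\<And>x y. x \<in> A \<Longrightarrow> y \<in> B \<Longrightarrow> \<phi> ((x + y) / 2) \<noteq> 0 \<Longrightarrow> f x = g y"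
    and x: "x \<in> live \<phi> A B"
  shows "eventually (\<lambda>x'. f x = f x') (at x)"
proof -
  obtain y where y: "x \<in> A" "y \<in> B" "\<phi> ((x + y) / 2) \<noteq> 0"
    using x by (auto simp: live_def)
  then obtain d where d: "d > 0" "ball x d \<subseteq> A" "ball y d \<subseteq> B"
    using common_ball[of A x B y] assms by blast
  define u where "u = (x + y) / 2"
  \<comment> \<open>Since \<open>y = 2 * u - x\<close>, a \<open>v\<close> within \<open>d/4\<close>
    of \<open>u\<close> has its reflected point \<open>2 * v - x\<close> within \<open>d/2\<close>
    of \<open>y\<close>, hence in \<open>B\<close>.\<close>
  define S where "S = {u - d/4..u + d/4}"
  define D where "D = {v \<in> S. \<phi> v \<noteq> 0}"
  have inB: "2 * v - x \<in> B" if "v \<in> S" for v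
  proof -
    have "\<bar>u - v\<bar> \<le> d / 4"
      using that unfolding S_def atLeastAtMost_iff by linarith
    moreover have "y - (2 * v - x) = 2 * (u - v)"
      by (simp add: u_def field_simps)
    then have "dist y (2 * v - x) = 2 * \<bar>u - v\<bar>"
      by (simp only: dist_real_def abs_mult)
    ultimately have "2 * v - x \<in> ball y d"
      using d(1) by simp
    then show ?thesis
      using d(3) by blast
  qed
  have "v \<in> half_sum A B" if "v \<in> S" for v
    using half_sumI[OF y(1) inB[OF that]] by simp
  then have "S \<subseteq> half_sum A B" ..
  then have S: "(\<Phi> has_real_derivative \<phi> v) (at v within S)" if "v \<in> S" for v
    using \<Phi> that by (meson has_field_derivative_subset subsetD)
  have "D \<in> lmeasurable"
    unfolding D_def S_def
    by (rule derivative_nonzero_lmeasurable[of _ _ \<Phi>]) (use S d in \<open>auto simp: S_def\<close>)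
  moreover have "\<not> negligible D"
    unfolding D_def S_def
    by (rule derivative_nonzero_not_negligible[of _ _ \<Phi> \<phi> u]) (use S d y in \<open>auto simp: S_def simp flip: u_def\<close>)
  moreover have "bounded D"
    unfolding D_def S_def by (rule bounded_subset[OF bounded_closed_interval]) blast
  ultimately obtain e where e: "e > 0" "\<And>h. \<bar>h\<bar> < e \<Longrightarrow> \<exists>v\<in>D. h + v \<in> D"
    using steinhaus[of D] unfolding real_norm_def by blast
  \<comment> \<open>The bound \<open>d\<close> keeps \<open>x'\<close> in \<open>A\<close>; the
    bound \<open>2 * e\<close> makes the displacement \<open>(x' - x) / 2\<close> of midpoints small
    enough for Steinhaus.\<close>
  have "f x = f x'" if x': "\<bar>x' - x\<bar> < min d (2 * e)" for x'
  proof -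
    obtain v where v: "v \<in> D" "(x' - x) / 2 + v \<in> D"
      using e(2)[of "(x' - x) / 2"] x' by auto
    have "x' \<in> A"
    proof -
      have "x' \<in> ball x d"
        using x' by (simp add: dist_real_def abs_minus_commute)
      then show ?thesis
        using d(2) by blast
    qed
    \<comment> \<open>The single partner \<open>2 * v - x\<close> serves both points: its midpoint
      with \<open>x\<close> is \<open>v\<close>, that with \<open>x'\<close> is the translate of
      \<open>v\<close>, and both lie in \<open>D\<close>.\<close>
    have "f x = g (2 * v - x)"
      by (rule eq) (use v inB[of v] y in \<open>simp_all add: D_def\<close>)
    moreover have "(x' + (2 * v - x)) / 2 = (x' - x) / 2 + v"
      by simp
    then have "f x' = g (2 * v - x)"
      by (intro eq) (use v inB[of v] \<open>x' \<in> A\<close> in \<open>simp_all only: D_def mem_Collect_eq, simp_all\<close>)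
    ultimately show ?thesis by simp
  qed
  then show ?thesis
    unfolding eventually_at using d e
    by (intro exI[of _ "min d (2 * e)"]) (auto simp: dist_real_def)
qed

section \<open>Extended endpoints of the parts of an interval below and above a closed
  subset\<close>

lemma einf_less:
  assumes "open I" "x \<in> I"
  shows "einf I < ereal x"
proof -
  obtain d where d: "d > 0" "cball x d \<subseteq> I"
    using assms by (meson open_contains_cball)
  then have "x - d \<in> I"
    by (auto simp: subset_iff dist_real_def)
  then show ?thesis
    using d by (auto simp: einf_def INF_less_iff intro!: bexI[of _ "x - d"])
qed

lemma less_esup:
  assumes "open I" "x \<in> I"
  shows "ereal x < esup I"
proof -
  obtain d where d: "d > 0" "cball x d \<subseteq> I"
    using assms by (meson open_contains_cball)
  then have "x + d \<in> I"
    by (auto simp: subset_iff dist_real_def)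
  then show ?thesis
    using d by (auto simp: esup_def less_SUP_iff intro!: bexI[of _ "x + d"])
qed

text \<open>This identifies the left interval of case (2) once \<open>einf K\<close> is taken as its
  right end. Points of the interval lie in \<open>I\<close> by convexity. Conversely, a point of
  \<open>I\<close> below all of \<open>K\<close> has positive distance from \<open>K\<close> by
  relative closedness, so it is strictly below \<open>einf K\<close>.\<close>

lemma einterval_einf:
  assumes I: "nonempty_open_interval I" and K: "closedin (top_of_set I) K" "K \<noteq> {}"
  shows "einterval (einf I) (einf K) = {x \<in> I. \<forall>k\<in>K. x < k}"
proof (intro equalityI subsetI)
  fix x assume "x \<in> einterval (einf I) (einf K)"
  then have "einf I < ereal x" "ereal x < einf K"
    by (auto simp: einterval_iff)
  then obtain y where "y \<in> I" "y < x" and less: "\<forall>k\<in>K. x < k"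
    using less_INF_D[of "ereal x" ereal K] by (auto simp: einf_def INF_less_iff)
  moreover obtain k where "k \<in> K" "k \<in> I"
    using K closedin_subset by fastforce
  ultimately have "x \<in> I"
    using I mem_is_interval_1_I[of I y k x] unfolding nonempty_open_interval_def
    by (meson less_imp_le)
  then show "x \<in> {x \<in> I. \<forall>k\<in>K. x < k}"
    using less by simp
next
  fix x assume "x \<in> {x \<in> I. \<forall>k\<in>K. x < k}"
  then have x: "x \<in> I" "\<forall>k\<in>K. x < k" by auto
  obtain C where C: "closed C" "K = I \<inter> C"
    using K by (auto simp: closedin_closed)
  then have "x \<in> - C" "open (- C)"
    using x by auto
  then obtain e where e: "e > 0" "ball x e \<subseteq> - C"
    by (meson open_contains_ball)
  have "x + e \<le> k" if "k \<in> K" for k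
  proof (rule ccontr)
    assume "\<not> ?thesis"
    then have "k \<in> ball x e"
      using x that by (auto simp: dist_real_def)
    then show False
      using e C that by blast
  qed
  then have "ereal (x + e) \<le> einf K"
    by (auto simp: einf_def le_INF_iff)
  moreover have "ereal x < ereal (x + e)"
    using e by simp
  ultimately have "ereal x < einf K"
    by (rule order_less_le_trans[rotated])
  with einf_less I x show "x \<in> einterval (einf I) (einf K)"
    by (simp add: einterval_iff nonempty_open_interval_def)
qed

lemma einterval_esup:
  assumes I: "nonempty_open_interval I" and K: "closedin (top_of_set I) K" "K \<noteq> {}"
  shows "einterval (esup K) (esup I) = {x \<in> I. \<forall>k\<in>K. k < x}"
proof (intro equalityI subsetI)
  fix x assume "x \<in> einterval (esup K) (esup I)"
  then have "ereal x < esup I" "esup K < ereal x"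
    by (auto simp: einterval_iff)
  then obtain y where "y \<in> I" "x < y" and less: "\<forall>k\<in>K. k < x"
    using SUP_lessD[of ereal K "ereal x"] by (auto simp: esup_def less_SUP_iff)
  moreover obtain k where "k \<in> K" "k \<in> I"
    using K closedin_subset by fastforce
  ultimately have "x \<in> I"
    using I mem_is_interval_1_I[of I k y x] unfolding nonempty_open_interval_def
    by (meson less_imp_le)
  then show "x \<in> {x \<in> I. \<forall>k\<in>K. k < x}"
    using less by simp
next
  fix x assume "x \<in> {x \<in> I. \<forall>k\<in>K. k < x}"
  then have x: "x \<in> I" "\<forall>k\<in>K. k < x" by auto
  obtain C where C: "closed C" "K = I \<inter> C"
    using K by (auto simp: closedin_closed)
  then have "x \<in> - C" "open (- C)"
    using x by auto
  then obtain e where e: "e > 0" "ball x e \<subseteq> - C"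
    by (meson open_contains_ball)
  have "k \<le> x - e" if "k \<in> K" for k
  proof (rule ccontr)
    assume "\<not> ?thesis"
    then have "k \<in> ball x e"
      using x that by (auto simp: dist_real_def)
    then show False
      using e C that by blast
  qed
  then have "esup K \<le> ereal (x - e)"
    by (auto simp: esup_def SUP_le_iff)
  also have "\<dots> < ereal x"
    using e by simp
  finally have "esup K < ereal x" .
  with less_esup I x show "x \<in> einterval (esup K) (esup I)"
    by (simp add: einterval_iff nonempty_open_interval_def)
qed

section \<open>From local constancy to common values on intervals\<close>

lemma constant_on_live:
  fixes f g :: "real \<Rightarrow> real"
  assumes A: "open A" and B: "open B"
    and \<Phi>: "\<And>u. u \<in> half_sum A B \<Longrightarrow> (\<Phi> has_real_derivative \<phi> u) (at u within half_sum A B)"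
    and eq: "\<And>x y. x \<in> A \<Longrightarrow> y \<in> B \<Longrightarrow> \<phi> ((x + y) / 2) \<noteq> 0 \<Longrightarrow> f x = g y"
    and S: "is_interval S" "S \<subseteq> live \<phi> A B" "x \<in> S" "x' \<in> S"
  shows "f x = f x'"
proof (rule connected_local_const[of S x x' f])
  show "connected S"
    using S by (simp add: is_interval_connected)
  show "\<forall>a\<in>S. \<forall>\<^sub>F b in at a within S. f a = f b"
  proof
    fix a assume "a \<in> S"
    then have "\<forall>\<^sub>F b in at a. f a = f b"
      by (intro locally_constant_on_live[OF A B \<Phi> eq]) (use S in auto)
    then show "\<forall>\<^sub>F b in at a within S. f a = f b"
      by (rule filter_leD[OF at_le[OF subset_UNIV]])
  qed
qed (use S in auto)

text \<open>Each function is constant on its own interval, and one pair with a nonzero midpoint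
  value ties the two constants together. Such a pair is demanded only for nonempty \<open>S\<close>,
  because otherwise the conclusion is vacuous.\<close>

lemma common_value_on_live:
  fixes f g :: "real \<Rightarrow> real"
  assumes A: "open A" and B: "open B"
    and \<Phi>: "\<And>u. u \<in> half_sum A B \<Longrightarrow> (\<Phi> has_real_derivative \<phi> u) (at u within half_sum A B)"
    and eq: "\<And>x y. x \<in> A \<Longrightarrow> y \<in> B \<Longrightarrow> \<phi> ((x + y) / 2) \<noteq> 0 \<Longrightarrow> f x = g y"
    and S: "is_interval S" "S \<subseteq> live \<phi> A B"
    and T: "is_interval T" "T \<subseteq> live \<phi> B A"
    and meet: "S \<noteq> {} \<Longrightarrow> \<exists>x\<in>S. \<exists>y\<in>T. \<phi> ((x + y) / 2) \<noteq> 0"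
  shows "\<exists>c. \<forall>x\<in>S. \<forall>y\<in>T. f x = c \<and> g y = c"
proof (cases "S = {}")
  case False
  then obtain x y where xy: "x \<in> S" "y \<in> T" "\<phi> ((x + y) / 2) \<noteq> 0"
    using meet by blast
  have "f x' = f x" if "x' \<in> S" for x'
    using constant_on_live[OF A B \<Phi> eq S that xy(1)] .
  moreover have "g y' = g y" if "y' \<in> T" for y'
  proof (rule constant_on_live[OF B A _ _ T that xy(2), where \<Phi> = \<Phi> and f = g and g = f])
    show "(\<Phi> has_real_derivative \<phi> u) (at u within half_sum B A)" if "u \<in> half_sum B A" for u
      using \<Phi> that by (simp add: half_sum_commute)
    show "g a = f b" if "a \<in> B" "b \<in> A" "\<phi> ((a + b) / 2) \<noteq> 0" for a b
      using eq[of b a] that by (simp add: add.commute)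
  qed
  moreover have "f x = g y"
    using xy S T by (intro eq) (auto simp: live_def)
  ultimately show ?thesis
    by (intro exI[of _ "g y"]) auto
qed simp

section \<open>Position of live points relative to the remaining points\<close>

text \<open>If \<open>x\<close> and \<open>y\<close> lay on different sides of some \<open>k\<close>
  and \<open>l\<close>, or on one of them, \<open>half_sum_cross\<close> would turn
  \<open>(x + y) / 2\<close> into a midpoint involving a point that is not live, where
  \<open>\<phi>\<close> vanishes.\<close>

lemma live_same_side:
  assumes A: "is_interval A" and B: "is_interval B"
    and K: "A - live \<phi> A B \<noteq> {}" and L: "B - live \<phi> B A \<noteq> {}"
    and xy: "x \<in> A" "y \<in> B" "\<phi> ((x + y) / 2) \<noteq> 0"
  shows "(\<forall>k\<in>A - live \<phi> A B. x < k) \<and> (\<forall>l\<in>B - live \<phi> B A. y < l) \<or>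
         (\<forall>k\<in>A - live \<phi> A B. k < x) \<and> (\<forall>l\<in>B - live \<phi> B A. l < y)"
proof -
  have "x < k \<and> y < l \<or> k < x \<and> l < y"
    if k: "k \<in> A - live \<phi> A B" and l: "l \<in> B - live \<phi> B A" for k l
  proof (rule ccontr)
    assume "\<not> ?thesis"
    then have "(x + y) / 2 \<in> half_sum {k} B \<union> half_sum A {l}"
      using k l xy by (intro half_sum_cross[OF A B]) auto
    also have "\<dots> \<subseteq> half_sum (A - live \<phi> A B) B \<union> half_sum (B - live \<phi> B A) A"
      using k l half_sum_mono[of "{k}" "A - live \<phi> A B" B B] half_sum_mono[of "{l}" "B - live \<phi> B A" A A]
      by (auto simp: half_sum_commute[of A])
    finally show False
      using xy(3) half_sum_not_live by blast
  qed
  \<comment> \<open>The side does not depend on the pair: a fixed \<open>l\<close> determines the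
    side for every \<open>k\<close>, and a fixed \<open>k\<close> that for every
    \<open>l\<close>.\<close>
  then show ?thesis
    using K L by (meson ex_in_conv less_asym)
qed

text \<open>A live point between two points that are not live would contradict
  \<open>live_same_side\<close>, which puts all of these on one side of it.\<close>

lemma is_interval_not_live:
  assumes A: "is_interval A" and B: "is_interval B" and L: "B - live \<phi> B A \<noteq> {}"
  shows "is_interval (A - live \<phi> A B)"
  unfolding is_interval_1
proof (intro ballI allI impI)
  fix k k' x assume k: "k \<in> A - live \<phi> A B" "k' \<in> A - live \<phi> A B" "k \<le> x \<and> x \<le> k'"
  then have "x \<in> A"
    using A mem_is_interval_1_I by blast
  moreover have False if x: "x \<in> live \<phi> A B"
  proof -
    obtain y where "y \<in> B" "\<phi> ((x + y) / 2) \<noteq> 0"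
      using x by (auto simp: live_def)
    moreover have "A - live \<phi> A B \<noteq> {}"
      using k by blast
    ultimately show False
      using live_same_side[OF A B _ L \<open>x \<in> A\<close>] k by (meson not_less)
  qed
  ultimately show "x \<in> A - live \<phi> A B"
    by blast
qed

lemma closedin_not_live:
  assumes "open A" "open B"
  shows "closedin (top_of_set A) (A - live \<phi> A B)"
  using open_live[OF assms, of \<phi>] by (auto simp: closedin_closed intro!: exI[of _ "- live \<phi> A B"])

lemma components_open_intervals:
  fixes S :: "real set"
  assumes "open S"
  shows "countable (components S)" "disjoint (components S)"
    "\<forall>U\<in>components S. nonempty_open_interval U"
proof -
  show "disjoint (components S)"
    using pairwise_disjoint_components[of S] by (simp add: pairwise_def disjnt_def)
  then show "countable (components S)"
    using assms open_components by (intro countable_disjoint_open_subsets) auto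
  show "\<forall>U\<in>components S. nonempty_open_interval U"
    using assms open_components in_components_connected in_components_nonempty
    unfolding nonempty_open_interval_def is_interval_connected_1 by blast
qed

lemma is_interval_below:
  fixes I :: "real set"
  assumes "is_interval I"
  shows "is_interval {x \<in> I. \<forall>k\<in>K. x < k}"
  unfolding is_interval_1
proof (intro ballI allI impI)
  fix a b x assume *: "a \<in> {x \<in> I. \<forall>k\<in>K. x < k}" "b \<in> {x \<in> I. \<forall>k\<in>K. x < k}" "a \<le> x \<and> x \<le> b"
  then have "x \<in> I"
    using assms mem_is_interval_1_I[of I a b x] by simp
  then show "x \<in> {x \<in> I. \<forall>k\<in>K. x < k}"
    using * by force
qed

lemma is_interval_above:
  fixes I :: "real set"
  assumes "is_interval I"
  shows "is_interval {x \<in> I. \<forall>k\<in>K. k < x}"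
  unfolding is_interval_1
proof (intro ballI allI impI)
  fix a b x assume *: "a \<in> {x \<in> I. \<forall>k\<in>K. k < x}" "b \<in> {x \<in> I. \<forall>k\<in>K. k < x}" "a \<le> x \<and> x \<le> b"
  then have "x \<in> I"
    using assms mem_is_interval_1_I[of I a b x] by simp
  then show "x \<in> {x \<in> I. \<forall>k\<in>K. k < x}"
    using * by force
qed

section \<open>Derivation of the three cases\<close>

text \<open>As all of the interval \<open>I j\<close> is live, \<open>\<psi> j\<close> is a constant
  \<open>c\<close>, and every live point of \<open>I i\<close> inherits \<open>c\<close> from a
  partner. Whether \<open>L\<close> fills \<open>I i\<close> decides between the alternatives. The
  indices stay symbolic so that both orders of 1 and 2 are covered.\<close>

lemma case_1_or_3_if_all_live:
  fixes i j :: nat and I :: "nat \<Rightarrow> real set" and \<phi> :: "real \<Rightarrow> real"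
    and \<psi> :: "nat \<Rightarrow> real \<Rightarrow> real"
  defines "L \<equiv> live \<phi> (I i) (I j)"
  assumes ij: "i \<in> {1, 2}" "j \<in> {1, 2}" "i \<noteq> j" and I: "open (I i)" "open (I j)" "is_interval (I j)"
    and \<Phi>: "\<And>u. u \<in> half_sum (I i) (I j) \<Longrightarrow>
        (\<Phi> has_real_derivative \<phi> u) (at u within half_sum (I i) (I j))"
    and eq: "\<And>x y. x \<in> I i \<Longrightarrow> y \<in> I j \<Longrightarrow> \<phi> ((x + y) / 2) \<noteq> 0 \<Longrightarrow> \<psi> i x = \<psi> j y"
    and live_j: "I j \<subseteq> live \<phi> (I j) (I i)" and "L \<noteq> {}"
  shows "(\<exists>c. (\<forall>x\<in>I i. \<psi> i x = c) \<and> (\<forall>y\<in>I j. \<psi> j y = c)) \<or> case_3 I \<phi> \<psi>"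
proof -
  have const: "\<psi> j y = \<psi> j y'" if "y \<in> I j" "y' \<in> I j" for y y'
  proof (rule constant_on_live[OF I(2,1) _ _ I(3) live_j that, where \<Phi> = \<Phi> and f = "\<psi> j" and g = "\<psi> i"])
    show "(\<Phi> has_real_derivative \<phi> u) (at u within half_sum (I j) (I i))" if "u \<in> half_sum (I j) (I i)" for u
      using \<Phi> that by (simp add: half_sum_commute)
    show "\<psi> j a = \<psi> i b" if "a \<in> I j" "b \<in> I i" "\<phi> ((a + b) / 2) \<noteq> 0" for a b
      using eq[of b a] that by (simp add: add.commute)
  qed
  obtain y0 where "y0 \<in> I j"
    using \<open>L \<noteq> {}\<close> by (auto simp: L_def live_def)
  define c where "c = \<psi> j y0"
  have j: "\<psi> j y = c" if "y \<in> I j" for y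
    using const[OF that \<open>y0 \<in> I j\<close>] by (simp add: c_def)
  have i: "\<psi> i x = c" if x: "x \<in> L" for x
  proof -
    obtain y where "x \<in> I i" "y \<in> I j" "\<phi> ((x + y) / 2) \<noteq> 0"
      using x by (auto simp: L_def live_def)
    then show ?thesis
      using eq[of x y] j[of y] by simp
  qed
  show ?thesis
  proof (cases "L = I i")
    case True
    then show ?thesis
      by (intro disjI1 exI[of _ c]) (simp add: i j)
  next
    case False
    have "L \<subseteq> I i"
      by (auto simp: L_def live_def)
    have "open L"
      unfolding L_def using I by (intro open_live)
    note comp = components_open_intervals[OF this]
    have "U \<subseteq> I i" if "U \<in> components L" for U
      using in_components_subset[OF that] \<open>L \<subseteq> I i\<close> by blast
    moreover have "\<phi> t = 0" if "t \<in> half_sum (I i - L) (I j)" for t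
      using that half_sum_not_live unfolding L_def by blast
    ultimately have "\<exists>\<U>. countable \<U> \<and> \<U> \<noteq> {} \<and> disjoint \<U> \<and>
        (\<forall>U\<in>\<U>. nonempty_open_interval U \<and> U \<subseteq> I i) \<and> \<Union>\<U> \<noteq> I i \<and>
        (\<forall>z\<in>\<Union>\<U>. \<psi> i z = c) \<and> (\<forall>t\<in>half_sum (I i - \<Union>\<U>) (I j). \<phi> t = 0)"
      using comp i False \<open>L \<noteq> {}\<close>
      by (intro exI[of _ "components L"] conjI) (simp_all only: Union_components, auto)
    then have ex: "\<exists>i\<in>{1, 2}. i \<noteq> j \<and> (\<exists>\<U>. countable \<U> \<and> \<U> \<noteq> {} \<and> disjoint \<U> \<and>
        (\<forall>U\<in>\<U>. nonempty_open_interval U \<and> U \<subseteq> I i) \<and> \<Union>\<U> \<noteq> I i \<and>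
        (\<forall>z\<in>\<Union>\<U>. \<psi> i z = c) \<and> (\<forall>t\<in>half_sum (I i - \<Union>\<U>) (I j). \<phi> t = 0))"
      using ij by (intro bexI[of _ i] conjI)
    have const_j: "\<forall>z\<in>I j. \<psi> j z = c"
      using j by blast
    have "case_3 I \<phi> \<psi>"
      unfolding case_3_def by (rule exI[of _ c], rule bexI[of _ j], rule conjI[OF const_j ex], rule ij(2))
    then show ?thesis ..
  qed
qed

text \<open>The witnesses for \<open>a i\<close> and \<open>b i\<close> are the infimum and supremum
  of \<open>K i\<close>, so that \<open>U i\<close> and \<open>V i\<close> consist of the points of
  \<open>I i\<close> below and above all of \<open>K i\<close>. By \<open>live_same_side\<close>,
  \<open>\<phi>\<close> is nonzero only at midpoints of \<open>U 1\<close> with \<open>U 2\<close>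
  or of \<open>V 1\<close> with \<open>V 2\<close>.\<close>

lemma case_2_if_none_all_live:
  fixes I :: "nat \<Rightarrow> real set" and \<phi> :: "real \<Rightarrow> real"
    and \<psi> :: "nat \<Rightarrow> real \<Rightarrow> real"
  defines "L \<equiv> \<lambda>i::nat. if i = 1 then live \<phi> (I 1) (I 2) else live \<phi> (I 2) (I 1)"
  defines "K \<equiv> \<lambda>i. I i - L i"
  assumes I1: "nonempty_open_interval (I 1)" and I2: "nonempty_open_interval (I 2)"
    and \<Phi>: "\<And>u. u \<in> half_sum (I 1) (I 2) \<Longrightarrow>
        (\<Phi> has_real_derivative \<phi> u) (at u within half_sum (I 1) (I 2))"
    and eq: "\<And>x y. x \<in> I 1 \<Longrightarrow> y \<in> I 2 \<Longrightarrow> \<phi> ((x + y) / 2) \<noteq> 0 \<Longrightarrow> \<psi> 1 x = \<psi> 2 y"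
    and K: "K 1 \<noteq> {}" "K 2 \<noteq> {}" and L: "L 1 \<noteq> {}"
  shows "case_2 I \<phi> \<psi>"
proof -
  have K1: "K 1 = I 1 - live \<phi> (I 1) (I 2)" and K2: "K 2 = I 2 - live \<phi> (I 2) (I 1)"
    by (simp_all add: K_def L_def)
  have open1: "open (I 1)" and int1: "is_interval (I 1)" and open2: "open (I 2)" and int2: "is_interval (I 2)"
    using I1 I2 by (auto simp: nonempty_open_interval_def)
  define U where "U = (\<lambda>i. {x \<in> I i. \<forall>k\<in>K i. x < k})"
  define V where "V = (\<lambda>i. {x \<in> I i. \<forall>k\<in>K i. k < x})"
  have side: "x \<in> U 1 \<and> y \<in> U 2 \<or> x \<in> V 1 \<and> y \<in> V 2"
    if "x \<in> I 1" "y \<in> I 2" "\<phi> ((x + y) / 2) \<noteq> 0" for x y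
    using live_same_side[OF int1 int2 _ _ that(1,2), of \<phi>] K that unfolding U_def V_def K1 K2 by blast
  have UV_live: "U 1 \<subseteq> live \<phi> (I 1) (I 2)" "U 2 \<subseteq> live \<phi> (I 2) (I 1)"
    "V 1 \<subseteq> live \<phi> (I 1) (I 2)" "V 2 \<subseteq> live \<phi> (I 2) (I 1)"
    unfolding U_def V_def K1 K2 by blast+
  have int_UV: "is_interval (U 1)" "is_interval (U 2)" "is_interval (V 1)" "is_interval (V 2)"
    using int1 int2 by (auto simp: U_def V_def intro: is_interval_below is_interval_above)
  have disj: "U 1 \<inter> V 1 = {}"
    using K(1) by (force simp: U_def V_def)
  \<comment> \<open>A point of \<open>U 1\<close> or \<open>V 1\<close> is live, and by
    \<open>side\<close> together with \<open>disj\<close> its partner lies in the set of the same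
    letter. This yields the tying pair that \<open>common_value_on_live\<close> asks for.\<close>
  have partner: "\<exists>y\<in>I 2. \<phi> ((x + y) / 2) \<noteq> 0" if "x \<in> U 1 \<union> V 1" for x
    using that UV_live(1,3) unfolding live_def by blast
  have meet_U: "\<exists>x\<in>U 1. \<exists>y\<in>U 2. \<phi> ((x + y) / 2) \<noteq> 0" if ne: "U 1 \<noteq> {}"
  proof -
    obtain x where x: "x \<in> U 1"
      using ne by blast
    then obtain y where "y \<in> I 2" "\<phi> ((x + y) / 2) \<noteq> 0"
      using partner by blast
    then show ?thesis
      using x side[of x y] disj U_def by blast
  qed
  have "\<exists>c. \<forall>x\<in>U 1. \<forall>y\<in>U 2. \<psi> 1 x = c \<and> \<psi> 2 y = c"
    by (rule common_value_on_live[OF open1 open2 \<Phi> eq int_UV(1) UV_live(1) int_UV(2) UV_live(2)];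
      (assumption | erule meet_U))
  then obtain c where c: "\<forall>x\<in>U 1. \<forall>y\<in>U 2. \<psi> 1 x = c \<and> \<psi> 2 y = c" ..
  have meet_V: "\<exists>x\<in>V 1. \<exists>y\<in>V 2. \<phi> ((x + y) / 2) \<noteq> 0" if ne: "V 1 \<noteq> {}"
  proof -
    obtain x where x: "x \<in> V 1"
      using ne by blast
    then obtain y where "y \<in> I 2" "\<phi> ((x + y) / 2) \<noteq> 0"
      using partner by blast
    then show ?thesis
      using x side[of x y] disj V_def by blast
  qed
  have "\<exists>d. \<forall>x\<in>V 1. \<forall>y\<in>V 2. \<psi> 1 x = d \<and> \<psi> 2 y = d"
    by (rule common_value_on_live[OF open1 open2 \<Phi> eq int_UV(3) UV_live(3) int_UV(4) UV_live(4)];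
      (assumption | erule meet_V))
  then obtain d where d: "\<forall>x\<in>V 1. \<forall>y\<in>V 2. \<psi> 1 x = d \<and> \<psi> 2 y = d" ..
  obtain x y where "x \<in> I 1" "y \<in> I 2" "\<phi> ((x + y) / 2) \<noteq> 0"
    using L by (auto simp: L_def live_def)
  then have nonempty: "U 1 \<noteq> {} \<and> U 2 \<noteq> {} \<or> V 1 \<noteq> {} \<and> V 2 \<noteq> {}"
    using side by blast
  have Ki: "K i \<noteq> {} \<and> is_interval (K i) \<and> closedin (top_of_set (I i)) (K i)"
    if "i \<in> {1, 2}" for i
  proof -
    have "is_interval (K 1)" "is_interval (K 2)"
      using K is_interval_not_live[OF int1 int2] is_interval_not_live[OF int2 int1] unfolding K1 K2 by blast+
    moreover have "closedin (top_of_set (I 1)) (K 1)" "closedin (top_of_set (I 2)) (K 2)"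
      using closedin_not_live open1 open2 unfolding K1 K2 by blast+
    ultimately show ?thesis
      using that K by auto
  qed
  have U: "einterval (einf (I i)) (einf (K i)) = U i" and V: "einterval (esup (K i)) (esup (I i)) = V i"
    if "i \<in> {1, 2}" for i
    using that I1 I2 Ki[OF that] einterval_einf[of "I i" "K i"] einterval_esup[of "I i" "K i"]
    by (auto simp: U_def V_def)
  \<comment> \<open>A point of \<open>I i\<close> neither below nor above all of \<open>K i\<close>
    lies between two points of \<open>K i\<close>, hence in it by convexity.\<close>
  have KUV: "I i - (U i \<union> V i) = K i" if "i \<in> {1, 2}" for i
  proof
    show "K i \<subseteq> I i - (U i \<union> V i)"
      by (auto simp: U_def V_def K_def)
    show "I i - (U i \<union> V i) \<subseteq> K i"
    proof
      fix x assume "x \<in> I i - (U i \<union> V i)"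
      then obtain k k' where "k \<in> K i" "k' \<in> K i" "k \<le> x" "x \<le> k'"
        by (auto simp: U_def V_def not_less)
      then show "x \<in> K i"
        using Ki[OF that] mem_is_interval_1_I by blast
    qed
  qed
  have bounds: "einf (I i) \<le> einf (K i) \<and> einf (K i) \<le> esup (K i) \<and> esup (K i) \<le> esup (I i)"
    if i: "i \<in> {1, 2}" for i
  proof (intro conjI)
    show "einf (I i) \<le> einf (K i)"
      unfolding einf_def K_def by (intro INF_superset_mono) auto
    show "esup (K i) \<le> esup (I i)"
      unfolding esup_def K_def by (intro SUP_subset_mono) auto
    obtain k where "k \<in> K i"
      using Ki[OF i] by blast
    then show "einf (K i) \<le> esup (K i)"
      unfolding einf_def esup_def by (intro order_trans[OF INF_lower SUP_upper])
  qed
  have zero: "\<forall>u\<in>half_sum (K 1) (I 2) \<union> half_sum (I 1) (K 2). \<phi> u = 0"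
  proof
    fix u assume "u \<in> half_sum (K 1) (I 2) \<union> half_sum (I 1) (K 2)"
    then show "\<phi> u = 0"
      using half_sum_not_live[of u "I 1" \<phi> "I 2"] half_sum_not_live[of u "I 2" \<phi> "I 1"]
      unfolding K1 K2 half_sum_commute[of "I 2 - live \<phi> (I 2) (I 1)"] by blast
  qed
  have ball: "(\<forall>i\<in>{1, 2}. P i) \<longleftrightarrow> P 1 \<and> P 2" for P :: "nat \<Rightarrow> bool"
    by simp
  have one: "1 \<in> {1, 2 :: nat}" and two: "2 \<in> {1, 2 :: nat}"
    by simp_all
  note UVK = U[OF one] U[OF two] V[OF one] V[OF two] KUV[OF one] KUV[OF two]
  have proper: "U i \<noteq> I i \<and> V i \<noteq> I i" if i: "i \<in> {1, 2}" for i
  proof -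
    obtain k where "k \<in> I i - (U i \<union> V i)"
      using Ki[OF i] unfolding KUV[OF i] by blast
    then show ?thesis
      by blast
  qed
  show ?thesis
    unfolding case_2_def Let_def ball
    by (rule exI[of _ c], rule exI[of _ d], rule exI[of _ "\<lambda>i. einf (K i)"], rule exI[of _ "\<lambda>i. esup (K i)"],
        unfold UVK, rule conjI[OF conjI[OF bounds[OF one] bounds[OF two]]],
        rule conjI[OF conjI[OF proper[OF one] proper[OF two]]], rule conjI[OF nonempty],
        rule conjI[OF c], rule conjI[OF d], rule conjI[OF conjI[OF Ki[OF one] Ki[OF two]] zero])
qed

section \<open>The converse: each case solves the equation\<close>

lemma solves_eq_if_case_1:
  assumes "case_1 I \<phi> \<psi>"
  shows "solves_eq I \<phi> \<psi>"
  unfolding solves_eq_def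
proof (intro ballI)
  fix x y assume xy: "x \<in> I 1" "y \<in> I 2"
  then have "(x + y) / 2 \<in> half_sum (I 1) (I 2)"
    by (rule half_sumI)
  then have "\<phi> ((x + y) / 2) = 0 \<or> \<psi> 1 x = \<psi> 2 y"
    using assms xy unfolding case_1_def by metis
  then show "\<phi> ((x + y) / 2) * (\<psi> 1 x - \<psi> 2 y) = 0"
    by auto
qed

text \<open>Only pairs with one point in a \<open>U\<close> and the other in a \<open>V\<close> need
  an argument. They lie on opposite sides of chosen \<open>k\<close> in \<open>K 1\<close> and
  \<open>l\<close> in \<open>K 2\<close>, so \<open>half_sum_cross\<close> places their midpoint
  where \<open>\<phi>\<close> vanishes.\<close>

lemma solves_eq_if_case_2:
  assumes I1: "nonempty_open_interval (I 1)" and I2: "nonempty_open_interval (I 2)"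
    and "case_2 I \<phi> \<psi>"
  shows "solves_eq I \<phi> \<psi>"
  using assms(3) unfolding case_2_def Let_def
proof (elim exE conjE)
  fix c d :: real and a b :: "nat \<Rightarrow> ereal"
  assume *: "\<forall>x\<in>einterval (einf (I 1)) (a 1). \<forall>y\<in>einterval (einf (I 2)) (a 2). \<psi> 1 x = c \<and> \<psi> 2 y = c"
      "\<forall>x\<in>einterval (b 1) (esup (I 1)). \<forall>y\<in>einterval (b 2) (esup (I 2)). \<psi> 1 x = d \<and> \<psi> 2 y = d"
      "\<forall>i\<in>{1, 2}. I i - (einterval (einf (I i)) (a i) \<union> einterval (b i) (esup (I i))) \<noteq> {} \<and>
        is_interval (I i - (einterval (einf (I i)) (a i) \<union> einterval (b i) (esup (I i)))) \<and>
        closedin (top_of_set (I i)) (I i - (einterval (einf (I i)) (a i) \<union> einterval (b i) (esup (I i))))"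
      "\<forall>u\<in>half_sum (I 1 - (einterval (einf (I 1)) (a 1) \<union> einterval (b 1) (esup (I 1)))) (I 2) \<union>
          half_sum (I 1) (I 2 - (einterval (einf (I 2)) (a 2) \<union> einterval (b 2) (esup (I 2)))). \<phi> u = 0"
  define U where "U = (\<lambda>i. einterval (einf (I i)) (a i))"
  define V where "V = (\<lambda>i. einterval (b i) (esup (I i)))"
  define K where "K = (\<lambda>i. I i - (U i \<union> V i))"
  have c: "\<psi> 1 x = \<psi> 2 y" if "x \<in> U 1" "y \<in> U 2" for x y
    using *(1) that by (simp add: U_def)
  have d: "\<psi> 1 x = \<psi> 2 y" if "x \<in> V 1" "y \<in> V 2" for x y
    using *(2) that by (simp add: V_def)
  have K: "K 1 \<noteq> {}" "K 2 \<noteq> {}"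
    using *(3) unfolding U_def V_def K_def by blast+
  have zero: "\<forall>u\<in>half_sum (K 1) (I 2) \<union> half_sum (I 1) (K 2). \<phi> u = 0"
    using *(4) unfolding U_def V_def K_def .
  obtain k l where kl: "k \<in> K 1" "l \<in> K 2"
    using K by blast
  have open_I: "open (I i)" if "i \<in> {1, 2}" for i
    using that I1 I2 by (auto simp: nonempty_open_interval_def)
  \<comment> \<open>As \<open>I i\<close> is open, \<open>k\<close> exceeds
    \<open>einf (I i)\<close>; being outside \<open>U i\<close>, it is then at least
    \<open>a i\<close>, which exceeds \<open>x\<close>.\<close>
  have below: "x \<le> k" if "x \<in> U i" "k \<in> K i" "i \<in> {1, 2}" for x k i
    using that einf_less[OF open_I[OF that(3)], of k]
    by (auto simp: U_def K_def einterval_iff not_less dest: less_le_trans)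
  have above: "k \<le> x" if "x \<in> V i" "k \<in> K i" "i \<in> {1, 2}" for x k i
    using that less_esup[OF open_I[OF that(3)], of k]
    by (auto simp: V_def K_def einterval_iff not_less dest: le_less_trans)
  have "\<phi> ((x + y) / 2) = 0 \<or> \<psi> 1 x = \<psi> 2 y" if x: "x \<in> I 1" and y: "y \<in> I 2" for x y
  proof -
    consider "x \<in> K 1 \<or> y \<in> K 2" | "x \<in> U 1" "y \<in> U 2" | "x \<in> V 1" "y \<in> V 2"
      | "x \<le> k \<and> l \<le> y \<or> k \<le> x \<and> y \<le> l"
      using x y kl below[of _ 1] below[of _ 2] above[of _ 1] above[of _ 2]
      unfolding K_def by blast
    then show ?thesis
    proof cases
      case 1
      then show ?thesis
        using x y zero half_sumI by blast
    next
      case 4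
      then have "(x + y) / 2 \<in> half_sum {k} (I 2) \<union> half_sum (I 1) {l}"
        using x y kl I1 I2 by (intro half_sum_cross) (auto simp: nonempty_open_interval_def K_def)
      also have "\<dots> \<subseteq> half_sum (K 1) (I 2) \<union> half_sum (I 1) (K 2)"
        using kl by (intro Un_mono half_sum_mono) auto
      finally show ?thesis
        using zero by blast
    qed (use c d in auto)
  qed
  then show "solves_eq I \<phi> \<psi>"
    by (auto simp: solves_eq_def)
qed

lemma solves_eq_if_case_3:
  assumes "case_3 I \<phi> \<psi>"
  shows "solves_eq I \<phi> \<psi>"
  using assms unfolding case_3_def
proof (elim exE bexE conjE)
  fix c :: real and i j :: nat and \<U> :: "real set set"
  assume ij: "i \<in> {1, 2}" "j \<in> {1, 2}" "i \<noteq> j"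
    and j: "\<forall>z\<in>I j. \<psi> j z = c" and i: "\<forall>z\<in>\<Union>\<U>. \<psi> i z = c"
    and zero: "\<forall>t\<in>half_sum (I i - \<Union>\<U>) (I j). \<phi> t = 0"
  have *: "\<phi> ((x + y) / 2) = 0 \<or> \<psi> i x = \<psi> j y" if "x \<in> I i" "y \<in> I j" for x y
    using that i j zero half_sumI[of x "I i - \<Union>\<U>" y "I j"] by (cases "x \<in> \<Union>\<U>") auto
  consider "i = 1" "j = 2" | "i = 2" "j = 1"
    using ij by blast
  then show ?thesis
  proof cases
    case 1
    then show ?thesis
      using * by (auto simp: solves_eq_def)
  next
    case 2
    have "\<phi> ((x + y) / 2) = 0 \<or> \<psi> 1 x = \<psi> 2 y" if "x \<in> I 1" "y \<in> I 2" for x y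
      using *[of y x] that unfolding 2 add.commute[of y x] by auto
    then show ?thesis
      by (auto simp: solves_eq_def)
  qed
qed

section \<open>Assembly of the two directions\<close>

lemma cases_if_solves_eq:
  assumes I: "nonempty_open_interval (I 1)" "nonempty_open_interval (I 2)"
    and solves: "solves_eq I \<phi> \<psi>"
    and \<Phi>: "\<And>u. u \<in> half_sum (I 1) (I 2) \<Longrightarrow>
        (\<Phi> has_real_derivative \<phi> u) (at u within half_sum (I 1) (I 2))"
  shows "case_1 I \<phi> \<psi> \<or> case_2 I \<phi> \<psi> \<or> case_3 I \<phi> \<psi>"
proof (cases "case_1 I \<phi> \<psi>")
  case False
  then obtain u where "u \<in> half_sum (I 1) (I 2)" "\<phi> u \<noteq> 0"
    by (auto simp: case_1_def)
  then obtain x y where xy: "x \<in> I 1" "y \<in> I 2" "\<phi> ((x + y) / 2) \<noteq> 0"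
    by (metis half_sumE)
  have live1: "live \<phi> (I 1) (I 2) \<noteq> {}"
    using xy by (auto simp: live_def)
  have "\<phi> ((y + x) / 2) \<noteq> 0"
    using xy by (simp add: add.commute)
  then have live2: "live \<phi> (I 2) (I 1) \<noteq> {}"
    using xy by (auto simp: live_def)
  have eq: "\<psi> 1 x = \<psi> 2 y" if "x \<in> I 1" "y \<in> I 2" "\<phi> ((x + y) / 2) \<noteq> 0" for x y
    using solves that by (auto simp: solves_eq_def)
  have eq': "\<psi> 2 y = \<psi> 1 x" if "y \<in> I 2" "x \<in> I 1" "\<phi> ((y + x) / 2) \<noteq> 0" for x y
    using eq[of x y] that by (simp add: add.commute)
  have I': "open (I 1)" "is_interval (I 1)" "open (I 2)" "is_interval (I 2)"
    using I by (auto simp: nonempty_open_interval_def)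
  \<comment> \<open>This rules out the first alternative of \<open>case_1_or_3_if_all_live\<close>,
    leaving case (3).\<close>
  have not_const: "\<not> (\<exists>c. (\<forall>x\<in>I 1. \<psi> 1 x = c) \<and> (\<forall>y\<in>I 2. \<psi> 2 y = c))"
    using False unfolding case_1_def by blast
  \<comment> \<open>The split is by which of \<open>K\<^sub>2\<close> and \<open>K\<^sub>1\<close>
    is empty; the last alternative, with neither empty, leads to case (2).\<close>
  consider "I 2 \<subseteq> live \<phi> (I 2) (I 1)" | "I 1 \<subseteq> live \<phi> (I 1) (I 2)"
    | "I 1 - live \<phi> (I 1) (I 2) \<noteq> {}" "I 2 - live \<phi> (I 2) (I 1) \<noteq> {}"
    by blast
  then show ?thesis
  proof cases
    case 1
    then show ?thesis
      using case_1_or_3_if_all_live[of 1 2 I \<Phi> \<phi> \<psi>] I' \<Phi> eq live1 not_const by auto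
  next
    case 2
    then show ?thesis
      using case_1_or_3_if_all_live[of 2 1 I \<Phi> \<phi> \<psi>] I' \<Phi>[folded half_sum_commute[of "I 2"]] eq' live2 not_const
      by auto
  next
    case 3
    then show ?thesis
      using case_2_if_none_all_live[OF I \<Phi> eq] live1 by simp
  qed
qed simp

text \<open>The cases are joined by a plain disjunction because \<open>cases_1_2_3_overlap\<close>
  and \<open>cases_2_3_overlap\<close> exhibit solutions to which several of them apply.\<close>

theorem theorem3:
  fixes I :: "nat \<Rightarrow> real set" and J :: "real set"
    and \<phi> :: "real \<Rightarrow> real" and \<psi> :: "nat \<Rightarrow> real \<Rightarrow> real"
  assumes "nonempty_open_interval (I 1)" and "nonempty_open_interval (I 2)"
    and "J = half_sum (I 1) (I 2)"
  shows "(solves_eq I \<phi> \<psi> \<and> (\<exists>\<Phi>. \<forall>u \<in> J. (\<Phi> has_real_derivative \<phi> u) (at u within J)) \<longrightarrow>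
            case_1 I \<phi> \<psi> \<or> case_2 I \<phi> \<psi> \<or> case_3 I \<phi> \<psi>) \<and>
         (case_1 I \<phi> \<psi> \<or> case_2 I \<phi> \<psi> \<or> case_3 I \<phi> \<psi> \<longrightarrow> solves_eq I \<phi> \<psi>)"
proof (intro conjI impI)
  assume *: "solves_eq I \<phi> \<psi> \<and> (\<exists>\<Phi>. \<forall>u \<in> J. (\<Phi> has_real_derivative \<phi> u) (at u within J))"
  then obtain \<Phi> where "\<forall>u \<in> J. (\<Phi> has_real_derivative \<phi> u) (at u within J)"
    by blast
  then show "case_1 I \<phi> \<psi> \<or> case_2 I \<phi> \<psi> \<or> case_3 I \<phi> \<psi>"
    using * by (intro cases_if_solves_eq[OF assms(1,2), of \<phi> \<psi> \<Phi>]) (simp_all add: assms(3))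
next
  assume "case_1 I \<phi> \<psi> \<or> case_2 I \<phi> \<psi> \<or> case_3 I \<phi> \<psi>"
  then show "solves_eq I \<phi> \<psi>"
    using solves_eq_if_case_1 solves_eq_if_case_2[OF assms(1,2)] solves_eq_if_case_3 by blast
qed

end
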